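(* Let $n\ge 3$ and let $K_n$ be the complete graph on $n$ vertices. Then: (1) $\omega_f(K_n)=n$; (2) $K_n$ is not uniquely intersectable with respect to families (not u.i.f.).
   Context: All graphs are finite, simple and undirected. For a finite set $X$ and a finite (multi)family $\mathcal{F}$ of nonempty subsets of $X$, write $\mathbf{S}(\mathcal{F})=\bigcup_{S\in\mathcal{F}}S$. A multifamily representation of a graph $G$ is an assignment $v\mapsto S_v$ of a nonempty finite set to each vertex $v$ such that for all distinct vertices $u,v$, $|S_u\cap S_v|=1$ if $uv$ is an edge and $|S_u\cap S_v|=0$ otherwise (i.e. $G$ is the intersection multigraph of the family, whose edge multiplicities are the intersection sizes). It is a family representation if the sets $S_v$ are pairwise distinct. The family intersection number $\omega_f(G)$ is the minimum of $|\mathbf{S}(\mathcal{F})|$ over all family representations $\mathcal{F}$ of $G$. $G$ is uniquely intersectable with respect to families (u.i.f.) if, for a set $X$ with $|X|=\omega_f(G)$, any two family representations $\alpha,\beta$ of $G$ by subsets of $X$ are such that $\beta$ is obtained from $\alpha$ by a permutation of the elements of $X$. *)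

theory Defs
  imports "Graph_Theory.Graph_Theory" "HOL-Combinatorics.Permutations"
begin

text \<open>
  Finite simple undirected graphs are the symmetric digraphs of the locale \<^locale>\<open>graph\<close>: an edge
  between \<open>u\<close> and \<open>v\<close> is the pair of opposite arcs, so adjacency is \<open>u \<rightarrow>\<^bsub>G\<^esub> v\<close>.

  A representation is a labelled assignment of sets to vertices; its values outside
  \<open>verts G\<close> are irrelevant.
\<close>

definition multifamily_representation :: "('a, 'b) pre_digraph \<Rightarrow> ('a \<Rightarrow> 'x set) \<Rightarrow> bool" where
  "multifamily_representation G S \<longleftrightarrow>
     (\<forall>v \<in> verts G. finite (S v) \<and> S v \<noteq> {}) \<and>
     (\<forall>u \<in> verts G. \<forall>v \<in> verts G. u \<noteq> v \<longrightarrow>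
        card (S u \<inter> S v) = (if u \<rightarrow>\<^bsub>G\<^esub> v then 1 else 0))"

definition family_representation :: "('a, 'b) pre_digraph \<Rightarrow> ('a \<Rightarrow> 'x set) \<Rightarrow> bool" where
  "family_representation G S \<longleftrightarrow> multifamily_representation G S \<and> inj_on S (verts G)"

text \<open>
  The points of the sets are taken to be natural numbers; since only finitely many points occur
  in a representation of a finite graph, this is no restriction. The infimum is a minimum, by
  \<open>family_representation_exists\<close> below.
\<close>

definition family_intersection_number :: "('a, 'b) pre_digraph \<Rightarrow> nat" (\<open>\<omega>\<^sub>f\<close>) where
  "\<omega>\<^sub>f G = Inf {card (\<Union>v \<in> verts G. S v) | S :: 'a \<Rightarrow> nat set. family_representation G S}"

definition uif :: "('a, 'b) pre_digraph \<Rightarrow> bool" where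
  "uif G \<longleftrightarrow>
     (\<forall>X :: nat set. finite X \<and> card X = \<omega>\<^sub>f G \<longrightarrow>
        (\<forall>\<alpha> \<beta>. family_representation G \<alpha> \<and> (\<forall>v \<in> verts G. \<alpha> v \<subseteq> X) \<and>
               family_representation G \<beta> \<and> (\<forall>v \<in> verts G. \<beta> v \<subseteq> X) \<longrightarrow>
           (\<exists>\<pi>. \<pi> permutes X \<and> (\<forall>v \<in> verts G. \<beta> v = \<pi> ` \<alpha> v))))"

lemma family_representation_exists:
  assumes "graph G"
  shows "\<exists>S :: 'a \<Rightarrow> nat set. family_representation (G :: ('a, 'b) pre_digraph) S"
proof -
  interpret graph G by fact
  obtain f :: "'a set \<Rightarrow> nat" where f: "inj_on f (Pow (verts G))"
    using finite_imp_inj_to_nat_seg[of "Pow (verts G)"] by auto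
  define T where "T v = insert {v} {{v, w} | w. v \<rightarrow>\<^bsub>G\<^esub> w}" for v
  define S where "S v = f ` T v" for v
  have adj: "u \<in> verts G" "v \<in> verts G" if "u \<rightarrow>\<^bsub>G\<^esub> v" for u v
    using that by (auto simp: arcs_ends_def arc_to_ends_def)
  have sym: "v \<rightarrow>\<^bsub>G\<^esub> u" if "u \<rightarrow>\<^bsub>G\<^esub> v" for u v
    using that sym_arcs by (auto simp: symmetric_def dest: symD)
  have T: "T v \<subseteq> Pow (verts G)" if "v \<in> verts G" for v
    using that adj by (auto simp: T_def)
  have fin: "finite (S v)" if "v \<in> verts G" for v
    using T[OF that] finite_verts unfolding S_def by (meson finite_Pow_iff finite_imageI finite_subset)
  have int: "T u \<inter> T v = (if u \<rightarrow>\<^bsub>G\<^esub> v then {{u, v}} else {})" if "u \<noteq> v" for u v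
    using that sym by (auto simp: T_def doubleton_eq_iff)
  have "card (S u \<inter> S v) = (if u \<rightarrow>\<^bsub>G\<^esub> v then 1 else 0)"
    if "u \<in> verts G" "v \<in> verts G" "u \<noteq> v" for u v
  proof -
    have "S u \<inter> S v = f ` (T u \<inter> T v)"
      unfolding S_def using inj_on_image_Int[OF f T T] that by metis
    then show ?thesis using int[OF \<open>u \<noteq> v\<close>] by simp
  qed
  moreover have "inj_on S (verts G)"
  proof (rule inj_onI)
    fix u v assume uv: "u \<in> verts G" "v \<in> verts G" "S u = S v"
    then have "T u = T v"
      unfolding S_def using inj_on_image_eq_iff[OF f T T] by metis
    then have "{u} \<in> T v" by (auto simp: T_def)
    then show "u = v" by (auto simp: T_def)
  qed
  moreover have "S v \<noteq> {}" for v
    by (simp add: S_def T_def)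
  ultimately show ?thesis
    using fin unfolding family_representation_def multifamily_representation_def by blast
qed

end

theory Submission
  imports Defs
begin

text \<open>
  The lower bound is Fisher's inequality: if there were fewer points than sets, some nonzero
  weighting of the sets would have total weight zero at every point, and expanding the sum over
  the points of the squared totals shows that this is impossible. Two families on \<open>n\<close> points that
  no permutation can relate, because only the first contains a singleton, are the sunflower
  \<open>{0}\<close>, \<open>{0, i}\<close> and the near-pencil \<open>{1, \<dots>, n - 1}\<close>, \<open>{0, i}\<close>, where \<open>0 < i < n\<close>.
\<close>

text \<open>Gaussian elimination. An equation with all coefficients zero is dropped; any other is
  solved for an unknown \<open>p\<close> with nonzero coefficient, and substituting leaves one
  equation and one unknown fewer.\<close>

lemma homogeneous_system_nontrivial_solution:
  fixes a :: "'x \<Rightarrow> 'v \<Rightarrow> 'f::field"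
  assumes "finite X" "finite V" "card X < card V"
  shows "\<exists>c. (\<exists>v\<in>V. c v \<noteq> 0) \<and> (\<forall>x\<in>X. (\<Sum>v\<in>V. a x v * c v) = 0)"
  using assms
proof (induction X arbitrary: V a rule: finite_induct)
  case empty
  then have "V \<noteq> {}" by auto
  then show ?case by (intro exI[of _ "\<lambda>_. 1"]) auto
next
  case (insert x X)
  show ?case
  proof (cases "\<forall>v\<in>V. a x v = 0")
    case True
    with insert show ?thesis by (fastforce simp: card_insert_if)
  next
    case False
    then obtain p where p: "p \<in> V" "a x p \<noteq> 0" by blast
    let ?V = "V - {p}"
    let ?a = "\<lambda>y v. a y v - a y p * a x v / a x p"
    have "card X < card ?V" using insert p by simp
    then obtain c where c: "\<exists>v\<in>?V. c v \<noteq> 0" "\<And>y. y \<in> X \<Longrightarrow> (\<Sum>v\<in>?V. ?a y v * c v) = 0"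
      using insert.IH[of ?V ?a] insert.prems by auto
    \<comment> \<open>Back substitution: equation \<open>x\<close> forces this value at
      \<open>p\<close>, and with it the other equations for \<open>d\<close> become the reduced ones
      for \<open>c\<close>. Off \<open>p\<close> nothing changes, so \<open>d\<close> stays
      nonzero.\<close>
    define d where "d = c(p := - (\<Sum>v\<in>?V. a x v * c v) / a x p)"
    have split: "(\<Sum>v\<in>V. a y v * d v) =
        (\<Sum>v\<in>?V. a y v * c v) - a y p * (\<Sum>v\<in>?V. a x v * c v) / a x p" for y
      using p insert.prems by (simp add: sum.remove[of V p] d_def)
    have "(\<Sum>v\<in>V. a y v * d v) = (\<Sum>v\<in>?V. ?a y v * c v)" for y
      unfolding split
      by (simp add: left_diff_distrib sum_subtractf sum_distrib_left sum_divide_distrib mult.assoc)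
    moreover have "(\<Sum>v\<in>V. a x v * d v) = 0"
      unfolding split using p by simp
    moreover have "\<exists>v\<in>V. d v \<noteq> 0"
      using c(1) by (auto simp: d_def)
    ultimately show ?thesis using c(2) by (intro exI[of _ d]) auto
  qed
qed

text \<open>After expanding the squares and summing over points first, the product
  \<open>c u * c v\<close> is counted once for each point of \<open>S u \<inter> S v\<close>. Off
  the diagonal this is \<open>k\<close> times; the excess over \<open>k\<close> on the diagonal
  gives the second sum.\<close>

lemma sum_incidence_squares:
  fixes c :: "'v \<Rightarrow> real"
  assumes "finite X" "finite V" "\<And>v. v \<in> V \<Longrightarrow> S v \<subseteq> X"
    and "\<And>u v. u \<in> V \<Longrightarrow> v \<in> V \<Longrightarrow> u \<noteq> v \<Longrightarrow> card (S u \<inter> S v) = k"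
  shows "(\<Sum>x\<in>X. (\<Sum>v\<in>V. of_bool (x \<in> S v) * c v)\<^sup>2) =
    real k * (\<Sum>v\<in>V. c v)\<^sup>2 + (\<Sum>v\<in>V. (real (card (S v)) - real k) * (c v)\<^sup>2)"
proof -
  have "(\<Sum>x\<in>X. (\<Sum>v\<in>V. of_bool (x \<in> S v) * c v)\<^sup>2) =
      (\<Sum>x\<in>X. \<Sum>u\<in>V. \<Sum>v\<in>V. of_bool (x \<in> S u \<inter> S v) * (c u * c v))"
    by (simp add: power2_eq_square sum_product of_bool_conj mult_ac)
  also have "\<dots> = (\<Sum>u\<in>V. \<Sum>v\<in>V. \<Sum>x\<in>X. of_bool (x \<in> S u \<inter> S v) * (c u * c v))"
    by (subst sum.swap, rule sum.cong[OF refl], rule sum.swap)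
  also have "\<dots> = (\<Sum>u\<in>V. \<Sum>v\<in>V. real k * (c u * c v) +
      (if v = u then (real (card (S v)) - real k) * (c v)\<^sup>2 else 0))"
  proof (intro sum.cong refl)
    fix u v assume uv: "u \<in> V" "v \<in> V"
    have "X \<inter> {x. x \<in> S u \<inter> S v} = S u \<inter> S v" using assms(3) uv by blast
    then have "(\<Sum>x\<in>X. of_bool (x \<in> S u \<inter> S v) * (c u * c v)) = real (card (S u \<inter> S v)) * (c u * c v)"
      using assms(1) by (simp flip: sum_distrib_right)
    then show "(\<Sum>x\<in>X. of_bool (x \<in> S u \<inter> S v) * (c u * c v)) = real k * (c u * c v) +
        (if v = u then (real (card (S v)) - real k) * (c v)\<^sup>2 else 0)"
      using assms(4) uv by (auto simp: power2_eq_square algebra_simps)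
  qed
  also have "\<dots> = real k * (\<Sum>v\<in>V. c v)\<^sup>2 + (\<Sum>v\<in>V. (real (card (S v)) - real k) * (c v)\<^sup>2)"
  proof -
    have "(\<Sum>u\<in>V. \<Sum>v\<in>V. real k * (c u * c v)) = real k * (\<Sum>v\<in>V. c v)\<^sup>2"
      by (simp only: power2_eq_square sum_product) (simp only: sum_distrib_left)
    then show ?thesis using assms(2) by (simp add: sum.distrib)
  qed
  finally show ?thesis .
qed

text \<open>For a weighting that vanishes at every point, both nonnegative terms of
  \<open>sum_incidence_squares\<close> are zero. The first makes the total weight zero; the second
  confines the weights to sets of size exactly \<open>k\<close>, and there is at most one such
  set.\<close>

theorem Fisher_inequality:
  assumes fin: "finite X" "finite V" and sub: "\<And>v. v \<in> V \<Longrightarrow> S v \<subseteq> X" and inj: "inj_on S V"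
    and int: "\<And>u v. u \<in> V \<Longrightarrow> v \<in> V \<Longrightarrow> u \<noteq> v \<Longrightarrow> card (S u \<inter> S v) = k"
    and "k > 0" and ge: "\<And>v. v \<in> V \<Longrightarrow> k \<le> card (S v)"
  shows "card V \<le> card X"
proof (rule ccontr)
  assume "\<not> card V \<le> card X"
  then obtain c :: "_ \<Rightarrow> real" where c: "\<exists>v\<in>V. c v \<noteq> 0"
      "\<forall>x\<in>X. (\<Sum>v\<in>V. of_bool (x \<in> S v) * c v) = 0"
    using homogeneous_system_nontrivial_solution[OF fin, of "\<lambda>x v. of_bool (x \<in> S v)"] by auto
  let ?q = "\<lambda>v. (real (card (S v)) - real k) * (c v)\<^sup>2"
  have "real k * (\<Sum>v\<in>V. c v)\<^sup>2 + sum ?q V = 0"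
    using sum_incidence_squares[of X V S k c] fin sub int c(2) by simp
  moreover have q: "?q v \<ge> 0" if "v \<in> V" for v
    using ge[OF that] by simp
  moreover have "sum ?q V \<ge> 0" using q by (rule sum_nonneg)
  moreover have "real k * (\<Sum>v\<in>V. c v)\<^sup>2 \<ge> 0" by simp
  ultimately have "sum ?q V = 0" "real k * (\<Sum>v\<in>V. c v)\<^sup>2 = 0" by linarith+
  then have c0: "(\<Sum>v\<in>V. c v) = 0" and "\<forall>v\<in>V. ?q v = 0"
    using \<open>k > 0\<close> sum_nonneg_eq_0_iff[of V ?q] fin q by auto
  then have small: "card (S v) = k" if "v \<in> V" "c v \<noteq> 0" for v
    using that by auto
  obtain w where w: "w \<in> V" "c w \<noteq> 0" using c(1) by blast
  \<comment> \<open>Two sets of size \<open>k\<close> that share \<open>k\<close> points coincide,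
    so injectivity leaves \<open>w\<close> as the only index with nonzero weight.\<close>
  have "c v = 0" if "v \<in> V" "v \<noteq> w" for v
  proof (rule ccontr)
    assume "c v \<noteq> 0"
    then have "card (S v) = k" "card (S w) = k" "card (S v \<inter> S w) = k"
      using small int w that by auto
    moreover have "finite (S v)" "finite (S w)"
      using sub fin w that by (meson finite_subset)+
    ultimately have "S v \<inter> S w = S v" "S v \<inter> S w = S w"
      by (simp_all add: card_subset_eq)
    then have "S v = S w" by simp
    then show False using inj w that by (auto dest: inj_onD)
  qed
  then have "(\<Sum>v\<in>V. c v) = c w"
    using w fin by (simp add: sum.remove[of V w])
  with c0 w show False by simp
qed

text \<open>Fisher's inequality with \<open>k = 1\<close>: all vertices are adjacent, so any two
  sets share exactly one point, and nonempty sets have size at least 1.\<close>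

lemma card_verts_le_card_Union_complete:
  assumes "K\<^bsub>n\<^esub> G" "family_representation G S"
  shows "n \<le> card (\<Union>v\<in>verts G. S v)"
proof -
  interpret graph G using assms(1) by (simp add: complete_digraph_def)
  have "card (verts G) \<le> card (\<Union>v\<in>verts G. S v)"
  proof (rule Fisher_inequality[where k = 1])
    show "1 \<le> card (S v)" if "v \<in> verts G" for v
      using assms(2) that unfolding family_representation_def multifamily_representation_def
      by (simp add: Suc_le_eq card_gt_0_iff)
  qed (use assms in \<open>auto simp: family_representation_def multifamily_representation_def
        complete_digraph_def\<close>)
  then show ?thesis using assms(1) by (simp add: complete_digraph_def)
qed

text \<open>Lets families be given on the indices below \<open>n\<close> and carried to the vertices
  along a numbering \<open>f\<close>; by symmetry only pairs \<open>i < j\<close> need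
  checking.\<close>

lemma family_representation_complete_compose:
  assumes "K\<^bsub>n\<^esub> G" "bij_betw f (verts G) {..<n}"
    and "\<And>i. i < n \<Longrightarrow> finite (B i) \<and> B i \<noteq> {}"
    and int: "\<And>i j. i < j \<Longrightarrow> j < n \<Longrightarrow> card (B i \<inter> B j) = 1"
    and "inj_on B {..<n}"
  shows "family_representation G (\<lambda>v. B (f v))"
proof -
  have lt: "f v < n" if "v \<in> verts G" for v
    using assms(2) that by (auto dest: bij_betwE)
  have "card (B i \<inter> B j) = 1" if "i < n" "j < n" "i \<noteq> j" for i j
    using int[of i j] int[of j i] that by (cases "i < j") (auto simp: Int_commute)
  moreover have "inj_on f (verts G)" using assms(2) by (rule bij_betw_imp_inj_on)
  moreover have "inj_on (B \<circ> f) (verts G)"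
    using assms(2,5) by (simp add: comp_inj_on bij_betw_def)
  ultimately show ?thesis
    using assms(1,3) lt
    unfolding family_representation_def multifamily_representation_def
    by (auto simp: complete_digraph_def comp_def inj_on_eq_iff)
qed

theorem theorem3p1:
  fixes G :: "('a, 'b) pre_digraph" and n :: nat
  assumes "n \<ge> 3" and "K\<^bsub>n\<^esub> G"
  shows "\<omega>\<^sub>f G = n \<and> \<not> uif G"
proof -
  interpret graph G using assms(2) by (simp add: complete_digraph_def)
  have "card (verts G) = n" using assms(2) by (simp add: complete_digraph_def)
  then obtain f where f: "bij_betw f (verts G) {..<n}"
    using finite_same_card_bij[OF finite_verts, of "{..<n}"] by auto
  \<comment> \<open>At index 0 this collapses to the singleton \<open>{0}\<close>.\<close>
  define sunflower :: "nat \<Rightarrow> nat set" where "sunflower i = {0, i}" for i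
  define pencil :: "nat \<Rightarrow> nat set" where "pencil i = (if i = 0 then {1..<n} else {0, i})" for i
  have "finite (pencil i) \<and> pencil i \<noteq> {}" for i
    using assms(1) by (simp add: pencil_def)
  moreover have "pencil i \<inter> pencil j = (if i = 0 then {j} else {0})" if "i < j" "j < n" for i j :: nat
    using that by (auto simp: pencil_def)
  moreover have "inj_on pencil {..<n}"
  proof (rule linorder_inj_onI)
    fix i j :: nat assume "i < j"
    \<comment> \<open>Since \<open>j > 0\<close>, \<open>pencil j\<close> is \<open>{0, j}\<close>.
      The long line \<open>pencil 0\<close> misses 0, and every other \<open>pencil i\<close> misses
      \<open>j\<close>.\<close>
    then have "0 \<in> pencil j" "j \<in> pencil j" "0 \<notin> pencil i \<or> j \<notin> pencil i"
      by (auto simp: pencil_def)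
    then show "pencil i \<noteq> pencil j" by blast
  qed auto
  ultimately have pencil: "family_representation G (\<lambda>v. pencil (f v))"
    by (intro family_representation_complete_compose[OF assms(2) f]) auto
  have "sunflower i \<inter> sunflower j = {0}" if "i < j" for i j :: nat
    using that by (auto simp: sunflower_def)
  then have sunflower: "family_representation G (\<lambda>v. sunflower (f v))"
    by (intro family_representation_complete_compose[OF assms(2) f])
      (auto simp: sunflower_def inj_on_def doubleton_eq_iff)
  have lt: "f v < n" if "v \<in> verts G" for v
    using f that by (auto dest: bij_betwE)
  have "(\<Union>v\<in>verts G. sunflower (f v)) = (\<Union>i<n. sunflower i)"
    unfolding bij_betw_imp_surj_on[OF f, symmetric] by simp
  also have "\<dots> = {..<n}" using assms(1) by (auto simp: sunflower_def)
  finally have "card (\<Union>v\<in>verts G. sunflower (f v)) = n" by simp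
  \<comment> \<open>The sunflower attains the lower bound given by Fisher's inequality.\<close>
  then have \<omega>: "\<omega>\<^sub>f G = n"
    unfolding family_intersection_number_def
    using sunflower card_verts_le_card_Union_complete[OF assms(2)]
    by (intro cInf_eq_minimum) (auto intro!: exI[of _ "\<lambda>v. sunflower (f v)"])
  have "\<not> uif G"
  proof
    assume "uif G"
    moreover have "pencil (f v) \<subseteq> {..<n}" "sunflower (f v) \<subseteq> {..<n}" if "v \<in> verts G" for v
      using lt[OF that] by (auto simp: pencil_def sunflower_def)
    ultimately obtain \<pi> where \<pi>: "\<pi> permutes {..<n}"
        "\<And>v. v \<in> verts G \<Longrightarrow> pencil (f v) = \<pi> ` sunflower (f v)"
      using pencil sunflower \<omega> unfolding uif_def
      by (metis (no_types, lifting) card_lessThan finite_lessThan)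
    \<comment> \<open>The vertex numbered 0 carries the singleton in one family and the long line in
      the other. A permutation preserves size, but the long line has \<open>n - 1 \<ge> 2\<close>
      points.\<close>
    obtain v where "v \<in> verts G" "f v = 0"
      using f assms(1) by (auto simp: bij_betw_def image_iff dest!: equalityD2 subsetD[of _ _ 0])
    with \<pi>(2) have "{1..<n} = {\<pi> 0}" by (force simp: pencil_def sunflower_def)
    then have "card {1..<n} = 1" by simp
    with assms(1) show False by simp
  qed
  with \<omega> show ?thesis by simp
qed

end
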